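(* Let $n,z,\mathcal{K}\ge1$ be integers and let $A$ be a $z$-ABEL-Spline function on $[0,1]^n$ with $\mathcal{K}$ pairs of exponential terms and trainable parameters $\theta\in\Theta$. Then for any $x\in[0,1]^n$ (and any parameter values $\theta$) the gradient with respect to the trainable parameters is non-zero: $\nabla_\theta A(\theta,x)\neq\vec 0$.
   Context: Cubic spline activation $S:\mathbb{R}\to\mathbb{R}$: $S(t)=\frac16t^3$ for $0\le t<1$; $S(t)=\frac16[-3(t-1)^3+3(t-1)^2+3(t-1)+1]$ for $1\le t<2$; $S(t)=\frac16[3(t-2)^3-6(t-2)^2+4]$ for $2\le t<3$; $S(t)=\frac16(4-t)^3$ for $3\le t<4$; $S(t)=0$ otherwise. A $z$-Spline ANN on $[0,1]^n$ with real trainable parameters $(\theta_{i,j})_{1\le i\le 4z+3,\,1\le j\le n}$ is $f(x)=\sum_{j=1}^n\sum_{i=1}^{4z+3}\theta_{i,j}\,S(4z\,x_j+4-i)$. A $z$-ABEL-Spline with $\mathcal{K}$ pairs of exponential terms is $$A(x)=F(x)+\sum_{k=1}^{\mathcal{K}}\frac1{k^2}\big(\exp(G_k(x))-\exp(H_k(x))\big),$$ where $F,G_1,\dots,G_{\mathcal K},H_1,\dots,H_{\mathcal K}$ are $z$-Spline ANNs on $[0,1]^n$, each with its own independent parameters. The trainable parameter vector $\theta$ of $A$ consists of all the parameters of these $2\mathcal{K}+1$ functions ($n(4z+3)(2\mathcal K+1)$ real parameters, $\Theta=\mathbb{R}^{n(4z+3)(2\mathcal K+1)}$), and $\nabla_\theta$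 is the gradient with respect to $\theta$. *)

theory Defs
  imports "HOL-Analysis.Analysis"
begin

definition spline_S :: "real \<Rightarrow> real" where
  "spline_S t =
     (if 0 \<le> t \<and> t < 1 then 1/6 * t^3
      else if 1 \<le> t \<and> t < 2 then 1/6 * (- 3 * (t - 1)^3 + 3 * (t - 1)^2 + 3 * (t - 1) + 1)
      else if 2 \<le> t \<and> t < 3 then 1/6 * (3 * (t - 2)^3 - 6 * (t - 2)^2 + 4)
      else if 3 \<le> t \<and> t < 4 then 1/6 * (4 - t)^3
      else 0)"

text \<open>A point of \<open>\<real>\<^sup>I\<close>, for a finite index set \<open>I\<close>, is an extensional function in
  \<open>I \<rightarrow>\<^sub>E UNIV\<close>; in particular \<open>[0,1]\<^sup>n\<close> is \<open>{1..n} \<rightarrow>\<^sub>E {0..1}\<close>.\<close>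

definition spline_ann :: "nat \<Rightarrow> nat \<Rightarrow> (nat \<times> nat \<Rightarrow> real) \<Rightarrow> (nat \<Rightarrow> real) \<Rightarrow> real" where
  "spline_ann n z \<phi> x =
     (\<Sum>j=1..n. \<Sum>i=1..4*z+3. \<phi> (i, j) * spline_S (4 * real z * x j + 4 - real i))"

text \<open>The parameter vector of an ABEL-Spline is indexed by pairs consisting of one of the component
  functions \<open>F\<close>, \<open>G\<^sub>k\<close>, \<open>H\<^sub>k\<close> and the index \<open>(i, j)\<close> of a parameter of that component.\<close>

datatype component = CompF | CompG nat | CompH nat

definition spline_components :: "nat \<Rightarrow> component set" where
  "spline_components K = {CompF} \<union> CompG ` {1..K} \<union> CompH ` {1..K}"

definition param_index :: "nat \<Rightarrow> nat \<Rightarrow> nat \<Rightarrow> (component \<times> nat \<times> nat) set" where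
  "param_index n z K = spline_components K \<times> {1..4*z+3} \<times> {1..n}"

lemma card_param_index: "card (param_index n z K) = n * (4*z+3) * (2*K+1)"
proof -
  have "card (CompG ` {1..K} \<union> CompH ` {1..K}) = K + K"
    by (subst card_Un_disjoint) (auto simp: card_image inj_on_def)
  moreover have "CompF \<notin> CompG ` {1..K} \<union> CompH ` {1..K}"
    by auto
  ultimately have "card (spline_components K) = 2*K+1"
    by (simp add: spline_components_def)
  then show ?thesis
    by (simp add: param_index_def card_cartesian_product algebra_simps)
qed

definition abel_spline ::
  "nat \<Rightarrow> nat \<Rightarrow> nat \<Rightarrow> (component \<times> nat \<times> nat \<Rightarrow> real) \<Rightarrow> (nat \<Rightarrow> real) \<Rightarrow> real" where
  "abel_spline n z K \<theta> x =
     spline_ann n z (\<lambda>q. \<theta> (CompF, q)) x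
     + (\<Sum>k=1..K. 1 / (real k)^2 *
          (exp (spline_ann n z (\<lambda>q. \<theta> (CompG k, q)) x)
           - exp (spline_ann n z (\<lambda>q. \<theta> (CompH k, q)) x)))"

definition along_coordinate :: "(('i \<Rightarrow> real) \<Rightarrow> real) \<Rightarrow> ('i \<Rightarrow> real) \<Rightarrow> 'i \<Rightarrow> real \<Rightarrow> real" where
  "along_coordinate f \<theta> p = (\<lambda>t. f (\<theta>(p := t)))"

text \<open>The vector of partial derivatives. As \<open>deriv\<close> is unspecified where no derivative exists,
  statements about it should be accompanied by \<open>has_partials\<close>.\<close>

definition gradient :: "'i set \<Rightarrow> (('i \<Rightarrow> real) \<Rightarrow> real) \<Rightarrow> ('i \<Rightarrow> real) \<Rightarrow> 'i \<Rightarrow> real" where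
  "gradient I f \<theta> = (\<lambda>p\<in>I. deriv (along_coordinate f \<theta> p) (\<theta> p))"

definition has_partials :: "'i set \<Rightarrow> (('i \<Rightarrow> real) \<Rightarrow> real) \<Rightarrow> ('i \<Rightarrow> real) \<Rightarrow> bool" where
  "has_partials I f \<theta> \<longleftrightarrow> (\<forall>p\<in>I. along_coordinate f \<theta> p field_differentiable at (\<theta> p))"

definition zero_vector :: "'i set \<Rightarrow> 'i \<Rightarrow> real" where
  "zero_vector I = (\<lambda>p\<in>I. 0)"

end

theory Submission
  imports Defs
begin

text \<open>
  Each parameter of \<open>F\<close> enters \<open>A\<close> linearly, so its partial derivative is the value at \<open>x\<close> of its
  B-spline basis function. The index \<open>i = \<lfloor>4 z x\<^sub>1\<rfloor> + 1\<close> places the argument of \<open>S\<close> in \<open>[3,4)\<close>,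
  where \<open>S\<close> is positive.
\<close>

text \<open>A spline network is linear in its parameters, so differentiating along \<open>p\<close>
  evaluates it at the unit vector of \<open>p\<close>. The indicator form also covers a
  \<open>p\<close> belonging to another component: the derivative is then 0.\<close>

lemma has_field_derivative_spline_ann_coordinate:
  "((\<lambda>t. spline_ann n z (\<lambda>q. (\<theta>(p := t)) (c, q)) x) has_field_derivative
     spline_ann n z (\<lambda>q. of_bool ((c, q) = p)) x) (at a)"
proof -
  have "((\<lambda>t. (\<theta>(p := t)) q) has_field_derivative of_bool (q = p)) (at a)" for q
    by (cases "q = p") auto
  then show ?thesis
    unfolding spline_ann_def by (intro DERIV_sum DERIV_cmult_right)
qed

text \<open>Sum and chain rules, for arbitrary \<open>p\<close>: \<open>has_partials\<close> needs
  every partial derivative, while the non-zero entry needs only one in \<open>CompF\<close>.\<close>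

lemma has_field_derivative_abel_spline_coordinate:
  "(along_coordinate (\<lambda>\<theta>'. abel_spline n z K \<theta>' x) \<theta> p has_field_derivative
     spline_ann n z (\<lambda>q. of_bool ((CompF, q) = p)) x
     + (\<Sum>k=1..K. 1 / (real k)^2 *
          (exp (spline_ann n z (\<lambda>q. \<theta> (CompG k, q)) x)
             * spline_ann n z (\<lambda>q. of_bool ((CompG k, q) = p)) x
           - exp (spline_ann n z (\<lambda>q. \<theta> (CompH k, q)) x)
             * spline_ann n z (\<lambda>q. of_bool ((CompH k, q) = p)) x))) (at (\<theta> p))"
proof -
  note D = has_field_derivative_spline_ann_coordinate[of n z \<theta> p _ x "\<theta> p"]
  \<comment> \<open>The chain rule leaves \<open>\<theta>(p := \<theta> p)\<close> inside
    \<open>exp\<close>; \<open>fun_upd_triv\<close> folds it back to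
    \<open>\<theta>\<close>.\<close>
  note E = DERIV_fun_exp[OF D, unfolded fun_upd_triv]
  show ?thesis
    unfolding along_coordinate_def abel_spline_def
    by (intro DERIV_add DERIV_sum DERIV_cmult DERIV_diff D E)
qed

lemma spline_ann_single:
  assumes "i \<in> {1..4*z+3}" and "j \<in> {1..n}"
  shows "spline_ann n z (\<lambda>q. of_bool (q = (i, j))) x = spline_S (4 * real z * x j + 4 - real i)"
proof -
  \<comment> \<open>Nesting the two conditions lets the inner sum collapse first, then the outer
    one.\<close>
  have "spline_ann n z (\<lambda>q. of_bool (q = (i, j))) x
      = (\<Sum>j'=1..n. \<Sum>i'=1..4*z+3.
          if i' = i then if j' = j then spline_S (4 * real z * x j' + 4 - real i') else 0 else 0)"
    unfolding spline_ann_def by (intro sum.cong) auto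
  with assms show ?thesis
    by simp
qed

lemma exists_spline_S_pos:
  assumes "0 \<le> y" and "y \<le> 1"
  shows "\<exists>i\<in>{1..4*z+3}. spline_S (4 * real z * y + 4 - real i) > 0"
proof -
  define u where "u = 4 * real z * y"
  define i where "i = nat \<lfloor>u\<rfloor> + 1"
  have u: "0 \<le> u" "u \<le> 4 * real z"
    using assms by (auto simp: u_def mult_left_le)
  \<comment> \<open>Hence \<open>i\<close> is at most \<open>4*z+1\<close>, attained at
    \<open>y = 1\<close>.\<close>
  have "nat \<lfloor>u\<rfloor> \<le> 4 * z"
    using u by linarith
  then have "i \<in> {1..4*z+3}"
    by (simp add: i_def)
  \<comment> \<open>The argument is 3 plus the fractional part of \<open>u\<close>, so it never
    reaches the zero of \<open>S\<close> at 4.\<close>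
  moreover have "3 \<le> u + 4 - real i" "u + 4 - real i < 4"
    using u(1) unfolding i_def by linarith+
  then have "spline_S (u + 4 - real i) > 0"
    by (simp add: spline_S_def)
  ultimately show ?thesis
    unfolding u_def by blast
qed

theorem proposition51:
  fixes n z K :: nat
    and \<theta> :: "component \<times> nat \<times> nat \<Rightarrow> real"
    and x :: "nat \<Rightarrow> real"
  assumes "n \<ge> 1" and "z \<ge> 1" and "K \<ge> 1"
    and "\<theta> \<in> param_index n z K \<rightarrow>\<^sub>E UNIV"
    and "x \<in> {1..n} \<rightarrow>\<^sub>E {0..1}"
  shows "has_partials (param_index n z K) (\<lambda>\<theta>'. abel_spline n z K \<theta>' x) \<theta> \<and>
         gradient (param_index n z K) (\<lambda>\<theta>'. abel_spline n z K \<theta>' x) \<theta>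
           \<noteq> zero_vector (param_index n z K)"
proof
  let ?I = "param_index n z K" and ?A = "\<lambda>\<theta>'. abel_spline n z K \<theta>' x"
  show "has_partials ?I ?A \<theta>"
    unfolding has_partials_def field_differentiable_def
    using has_field_derivative_abel_spline_coordinate by blast
  have one: "1 \<in> {1..n}"
    using assms(1) by simp
  then have "0 \<le> x 1" "x 1 \<le> 1"
    using assms(5) by (auto dest: PiE_mem)
  then obtain i where i: "i \<in> {1..4*z+3}" "spline_S (4 * real z * x 1 + 4 - real i) > 0"
    using exists_spline_S_pos by blast
  define p where "p = (CompF, i, 1 :: nat)"
  have p: "p \<in> ?I"
    using i(1) one by (simp add: p_def param_index_def spline_components_def)
  \<comment> \<open>As \<open>p\<close> lies in \<open>CompF\<close>, its indicator vanishes on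
    every \<open>CompG k\<close> and \<open>CompH k\<close>; this removes all exponential terms from
    the derivative.\<close>
  have zero: "spline_ann n z (\<lambda>q. 0) x = 0"
    by (simp add: spline_ann_def)
  have "deriv (along_coordinate ?A \<theta> p) (\<theta> p) = spline_ann n z (\<lambda>q. of_bool (q = (i, 1))) x"
    using DERIV_imp_deriv[OF has_field_derivative_abel_spline_coordinate[of n z K x \<theta> p]]
    by (simp add: p_def zero)
  also have "\<dots> = spline_S (4 * real z * x 1 + 4 - real i)"
    by (rule spline_ann_single[OF i(1) one])
  finally have "gradient ?I ?A \<theta> p \<noteq> zero_vector ?I p"
    using i(2) p by (simp add: gradient_def zero_vector_def)
  then show "gradient ?I ?A \<theta> \<noteq> zero_vector ?I"
    by metis
qed

end
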